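(* Let $(M^n,g)$, $n\ge2$, be the base manifold of a static perfect fluid spacetime $\tilde M=M\times_f\mathbb{R}$ with warping function $f>0$. If $M$ admits an almost gradient Ricci soliton whose potential function is the warping function $f$, i.e. $H^f+S+\lambda g=0$ on $M$ for some smooth function $\lambda$ on $M$, then $(M,g)$ is an Einstein manifold.
   Context: $(M^n,g)$ is a Riemannian manifold, $f>0$ a smooth function on $M$, and $\tilde M=M\times_f\mathbb{R}$ is $M\times\mathbb{R}$ with metric $\tilde g=g-f^2dt^2$. It is a static perfect fluid (SPF) spacetime with isotropic pressure $\rho$ (a smooth function) if, with $S$, $r$ the Ricci tensor and scalar curvature of $(M,g)$ and $H^f,\triangle f$ the Hessian and Laplacian (trace of the Hessian) of $f$ on $(M,g)$, $$f\Big(S-\frac rn g\Big)=H^f-\frac{\triangle f}{n}g,\qquad \triangle f=\Big(\frac{n-2}{2(n-1)}r+\frac{n}{n-1}\rho\Big)f .$$ "Einstein manifold" is understood here in the sense that $S=\kappa g$ for some smooth function $\kappa$ on $M$. *)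

theory Defs
  imports "HOL-Analysis.Analysis"
begin

section \<open>Smooth functions on open subsets of Euclidean space\<close>

definition partial :: "'n::finite \<Rightarrow> (real^'n \<Rightarrow> real) \<Rightarrow> real^'n \<Rightarrow> real" where
  "partial i F x = frechet_derivative F (at x) (axis i 1)"

text \<open>Only meant for open sets \<^term>\<open>D\<close>: the derivatives are taken with respect to the full filter
  \<^term>\<open>at x\<close>.\<close>

primrec Ck_on :: "nat \<Rightarrow> (real^'n::finite) set \<Rightarrow> (real^'n \<Rightarrow> real) \<Rightarrow> bool" where
  "Ck_on 0 D F \<longleftrightarrow> continuous_on D F"
| "Ck_on (Suc k) D F \<longleftrightarrow> (\<forall>x\<in>D. F differentiable (at x)) \<and> (\<forall>i. Ck_on k D (partial i F))"

definition Cinf_on :: "(real^'n::finite) set \<Rightarrow> (real^'n \<Rightarrow> real) \<Rightarrow> bool" where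
  "Cinf_on D F \<longleftrightarrow> (\<forall>k. Ck_on k D F)"


section \<open>Smooth manifolds\<close>

text \<open>A chart is a pair of its domain and its coordinate map; the dimension is \<open>CARD('n)\<close>.\<close>

type_synonym ('a, 'n) chart = "'a set \<times> ('a \<Rightarrow> real^'n)"

abbreviation chart_dom :: "('a, 'n::finite) chart \<Rightarrow> 'a set" where
  "chart_dom c \<equiv> fst c"

abbreviation coord :: "('a, 'n::finite) chart \<Rightarrow> 'a \<Rightarrow> real^'n" where
  "coord c \<equiv> snd c"

abbreviation chart_inv :: "('a, 'n::finite) chart \<Rightarrow> real^'n \<Rightarrow> 'a" where
  "chart_inv c \<equiv> inv_into (chart_dom c) (coord c)"

definition is_chart :: "'a topology \<Rightarrow> ('a, 'n::finite) chart \<Rightarrow> bool" where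
  "is_chart X c \<longleftrightarrow> openin X (chart_dom c) \<and> open (coord c ` chart_dom c) \<and>
     homeomorphic_map (subtopology X (chart_dom c)) (top_of_set (coord c ` chart_dom c)) (coord c)"

text \<open>Smoothness of the transition map from \<^term>\<open>c\<close> to \<^term>\<open>d\<close>; the predicate is used for both
  orders of each pair of charts.\<close>

definition smooth_transition :: "('a, 'n::finite) chart \<Rightarrow> ('a, 'n) chart \<Rightarrow> bool" where
  "smooth_transition c d \<longleftrightarrow>
     (\<forall>k. Cinf_on (coord c ` (chart_dom c \<inter> chart_dom d)) (\<lambda>x. coord d (chart_inv c x) $ k))"

locale smooth_manifold =
  fixes X :: "'a topology" and A :: "('a, 'n::finite) chart set"
  assumes Hausdorff: "Hausdorff_space X"
    and second_countable: "second_countable X"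
    and charts: "\<And>c. c \<in> A \<Longrightarrow> is_chart X c"
    and cover: "(\<Union>c\<in>A. chart_dom c) = topspace X"
    and compatible: "\<And>c d. c \<in> A \<Longrightarrow> d \<in> A \<Longrightarrow> smooth_transition c d"

definition smooth_function :: "('a, 'n::finite) chart set \<Rightarrow> ('a \<Rightarrow> real) \<Rightarrow> bool" where
  "smooth_function A h \<longleftrightarrow> (\<forall>c\<in>A. Cinf_on (coord c ` chart_dom c) (\<lambda>x. h (chart_inv c x)))"

text \<open>\<open>\<partial>h/\<partial>x\<^sup>i\<close> at the point \<^term>\<open>p\<close>, in the coordinates of the chart \<^term>\<open>c\<close>.\<close>

definition pd :: "('a, 'n::finite) chart \<Rightarrow> 'n \<Rightarrow> ('a \<Rightarrow> real) \<Rightarrow> 'a \<Rightarrow> real" where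
  "pd c i h p = partial i (\<lambda>x. h (chart_inv c x)) (coord c p)"


section \<open>Riemannian metrics\<close>

text \<open>A covariant 2-tensor field is given by its matrix of components \<open>T c p $ i $ j = T\<^sub>i\<^sub>j(p)\<close>
  in each chart \<^term>\<open>c\<close> of the atlas, related on overlaps by
  \<open>T\<^sub>i\<^sub>j = T'\<^sub>k\<^sub>l (\<partial>y\<^sup>k/\<partial>x\<^sup>i) (\<partial>y\<^sup>l/\<partial>x\<^sup>j)\<close>. Components at points outside \<^term>\<open>chart_dom c\<close> are irrelevant.\<close>

type_synonym ('a, 'n) tensor2 = "('a, 'n) chart \<Rightarrow> 'a \<Rightarrow> real^'n^'n"

definition tensor2_field :: "('a, 'n::finite) chart set \<Rightarrow> ('a, 'n) tensor2 \<Rightarrow> bool" where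
  "tensor2_field A T \<longleftrightarrow>
     (\<forall>c\<in>A. \<forall>d\<in>A. \<forall>p \<in> chart_dom c \<inter> chart_dom d. \<forall>i j.
        T c p $ i $ j =
          (\<Sum>k\<in>UNIV. \<Sum>l\<in>UNIV. T d p $ k $ l *
             pd c i (\<lambda>q. coord d q $ k) p * pd c j (\<lambda>q. coord d q $ l) p))"

locale riemannian_manifold = smooth_manifold X A
  for X :: "'a topology" and A :: "('a, 'n::finite) chart set" +
  fixes g :: "('a, 'n) tensor2"
  assumes metric_tensor: "tensor2_field A g"
    and metric_smooth: "\<And>c i j. c \<in> A \<Longrightarrow>
          Cinf_on (coord c ` chart_dom c) (\<lambda>x. g c (chart_inv c x) $ i $ j)"
    and metric_sym: "\<And>c p i j. c \<in> A \<Longrightarrow> p \<in> chart_dom c \<Longrightarrow> g c p $ i $ j = g c p $ j $ i"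
    and metric_pos: "\<And>c p v. c \<in> A \<Longrightarrow> p \<in> chart_dom c \<Longrightarrow> v \<noteq> 0 \<Longrightarrow> v \<bullet> (g c p *v v) > 0"


section \<open>Levi-Civita connection, curvature, Hessian\<close>

text \<open>\<open>\<Gamma>\<^sup>k\<^sub>i\<^sub>j = 1/2 g\<^sup>k\<^sup>l (\<partial>\<^sub>i g\<^sub>j\<^sub>l + \<partial>\<^sub>j g\<^sub>i\<^sub>l - \<partial>\<^sub>l g\<^sub>i\<^sub>j)\<close>\<close>

definition christoffel ::
    "('a, 'n::finite) tensor2 \<Rightarrow> ('a, 'n) chart \<Rightarrow> 'n \<Rightarrow> 'n \<Rightarrow> 'n \<Rightarrow> 'a \<Rightarrow> real" where
  "christoffel g c k i j p =
     1/2 * (\<Sum>l\<in>UNIV. matrix_inv (g c p) $ k $ l *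
        (pd c i (\<lambda>q. g c q $ j $ l) p + pd c j (\<lambda>q. g c q $ i $ l) p - pd c l (\<lambda>q. g c q $ i $ j) p))"

text \<open>\<open>S\<^sub>i\<^sub>j = \<partial>\<^sub>k \<Gamma>\<^sup>k\<^sub>i\<^sub>j - \<partial>\<^sub>j \<Gamma>\<^sup>k\<^sub>i\<^sub>k + \<Gamma>\<^sup>k\<^sub>k\<^sub>l \<Gamma>\<^sup>l\<^sub>i\<^sub>j - \<Gamma>\<^sup>k\<^sub>j\<^sub>l \<Gamma>\<^sup>l\<^sub>i\<^sub>k\<close>, with the sign for which round spheres
  have positive Ricci curvature.\<close>

definition ricci :: "('a, 'n::finite) tensor2 \<Rightarrow> ('a, 'n) tensor2" where
  "ricci g c p = (\<chi> i j. \<Sum>k\<in>UNIV.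
     pd c k (christoffel g c k i j) p - pd c j (christoffel g c k i k) p
     + (\<Sum>l\<in>UNIV. christoffel g c k k l p * christoffel g c l i j p
                  - christoffel g c k j l p * christoffel g c l i k p))"

text \<open>\<open>H\<^sup>f\<^sub>i\<^sub>j = \<partial>\<^sub>i \<partial>\<^sub>j f - \<Gamma>\<^sup>k\<^sub>i\<^sub>j \<partial>\<^sub>k f\<close>\<close>

definition hessian :: "('a, 'n::finite) tensor2 \<Rightarrow> ('a \<Rightarrow> real) \<Rightarrow> ('a, 'n) tensor2" where
  "hessian g f c p = (\<chi> i j.
     pd c i (pd c j f) p - (\<Sum>k\<in>UNIV. christoffel g c k i j p * pd c k f p))"

text \<open>\<open>tr\<^sub>g T = g\<^sup>i\<^sup>j T\<^sub>i\<^sub>j\<close>. It is computed in a chart, hence the chart argument here and below; for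
  tensor fields the value does not depend on it.\<close>

definition metric_trace ::
    "('a, 'n::finite) tensor2 \<Rightarrow> ('a, 'n) tensor2 \<Rightarrow> ('a, 'n) chart \<Rightarrow> 'a \<Rightarrow> real" where
  "metric_trace g T c p = (\<Sum>i\<in>UNIV. \<Sum>j\<in>UNIV. matrix_inv (g c p) $ i $ j * T c p $ i $ j)"

definition scalar_curvature ::
    "('a, 'n::finite) tensor2 \<Rightarrow> ('a, 'n) chart \<Rightarrow> 'a \<Rightarrow> real" where
  "scalar_curvature g = metric_trace g (ricci g)"

definition laplacian ::
    "('a, 'n::finite) tensor2 \<Rightarrow> ('a \<Rightarrow> real) \<Rightarrow> ('a, 'n) chart \<Rightarrow> 'a \<Rightarrow> real" where
  "laplacian g f = metric_trace g (hessian g f)"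


section \<open>Static perfect fluids, almost Ricci solitons, Einstein manifolds\<close>

text \<open>The warped product \<open>M \<times>\<^sub>f \<real>\<close> is determined by \<open>(M, g, f)\<close>, and for it to be a static perfect
  fluid spacetime with isotropic pressure \<open>\<rho>\<close> means that the two field equations below hold on the
  base. Tensor equations are required in every chart of the atlas.\<close>

definition static_perfect_fluid ::
    "'a topology \<Rightarrow> ('a, 'n::finite) chart set \<Rightarrow> ('a, 'n) tensor2 \<Rightarrow>
     ('a \<Rightarrow> real) \<Rightarrow> ('a \<Rightarrow> real) \<Rightarrow> bool" where
  "static_perfect_fluid X A g f \<rho> \<longleftrightarrow>
     smooth_function A f \<and> (\<forall>p\<in>topspace X. f p > 0) \<and> smooth_function A \<rho> \<and>
     (let n = real CARD('n) in \<forall>c\<in>A. \<forall>p\<in>chart_dom c.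
        f p *\<^sub>R (ricci g c p - (scalar_curvature g c p / n) *\<^sub>R g c p)
          = hessian g f c p - (laplacian g f c p / n) *\<^sub>R g c p \<and>
        laplacian g f c p
          = ((n - 2) / (2 * (n - 1)) * scalar_curvature g c p + n / (n - 1) * \<rho> p) * f p)"

definition almost_gradient_ricci_soliton ::
    "('a, 'n::finite) chart set \<Rightarrow> ('a, 'n) tensor2 \<Rightarrow> ('a \<Rightarrow> real) \<Rightarrow> ('a \<Rightarrow> real) \<Rightarrow> bool" where
  "almost_gradient_ricci_soliton A g f l \<longleftrightarrow>
     smooth_function A f \<and> smooth_function A l \<and>
     (\<forall>c\<in>A. \<forall>p\<in>chart_dom c. hessian g f c p + ricci g c p + l p *\<^sub>R g c p = 0)"

definition einstein_manifold ::
    "('a, 'n::finite) chart set \<Rightarrow> ('a, 'n) tensor2 \<Rightarrow> bool" where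
  "einstein_manifold A g \<longleftrightarrow>
     (\<exists>\<kappa>. smooth_function A \<kappa> \<and> (\<forall>c\<in>A. \<forall>p\<in>chart_dom c. ricci g c p = \<kappa> p *\<^sub>R g c p))"

end

theory Submission
  imports Defs
begin

text \<open>Substituting \<open>H\<^sup>f = - S - \<lambda> g\<close> turns the trace-free part of the Hessian into minus the
  trace-free part of the Ricci tensor, so the first fluid equation becomes
  \<open>(f + 1) (S - r/n g) = 0\<close>, and \<open>f > 0\<close> gives \<open>S = r/n g\<close>.

  It remains to see that \<open>r/n\<close> is a smooth function on the manifold. A direct proof would have to
  establish that the scalar curvature, which is given by a formula in each chart, is independent of
  the chart and smooth. The second fluid equation provides a shortcut: the trace of the soliton
  equation is \<open>\<triangle>f = - r - n \<lambda>\<close>, and equating this with the prescribed value of \<open>\<triangle>f\<close> gives a linear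
  equation for \<open>r\<close>, solved by
  \<open>r/n = - (\<lambda> + f \<rho> / (n - 1)) / (1 + (n - 2) f / (2 (n - 1)))\<close>.
  The denominator is at least \<open>1\<close>, so this is a quotient of smooth functions in which no curvature
  occurs; what is needed is only that smooth functions are closed under the field operations
  (\<open>smooth_function_add\<close>, \<open>smooth_function_mult\<close>, \<open>smooth_function_divide\<close>) and that the metric
  has trace \<open>n\<close> (\<open>metric_trace_metric\<close>).\<close>

section \<open>Algebra of smooth functions\<close>

lemma partial_eqI:
  assumes "(F has_derivative F') (at x)"
  shows "partial i F x = F' (axis i 1)"
  using frechet_derivative_at[OF assms] by (simp add: partial_def)

lemma has_derivative_eq_on_open:
  assumes "open D" "x \<in> D" "\<And>y. y \<in> D \<Longrightarrow> F y = G y" "(F has_derivative F') (at x)"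
  shows "(G has_derivative F') (at x)"
  by (rule has_derivative_transform_within_open[OF assms(4,1,2,3)])

lemma partial_add:
  assumes "F differentiable (at x)" "G differentiable (at x)"
  shows "partial i (\<lambda>x. F x + G x) x = partial i F x + partial i G x"
proof -
  from assms obtain F' G' where
    "(F has_derivative F') (at x)" "(G has_derivative G') (at x)"
    by (auto simp: differentiable_def)
  then show ?thesis
    by (simp add: partial_eqI partial_eqI[OF has_derivative_add])
qed

lemma partial_mult:
  assumes "F differentiable (at x)" "G differentiable (at x)"
  shows "partial i (\<lambda>x. F x * G x) x = F x * partial i G x + partial i F x * G x"
proof -
  from assms obtain F' G' where
    "(F has_derivative F') (at x)" "(G has_derivative G') (at x)"
    by (auto simp: differentiable_def)
  then show ?thesis
    by (simp add: partial_eqI partial_eqI[OF has_derivative_mult])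
qed

lemma partial_inverse:
  assumes "F differentiable (at x)" "F x \<noteq> 0"
  shows "partial i (\<lambda>x. inverse (F x)) x = - 1 * (partial i F x * (inverse (F x) * inverse (F x)))"
proof -
  from assms obtain F' where F': "(F has_derivative F') (at x)"
    by (auto simp: differentiable_def)
  then show ?thesis
    using partial_eqI[OF Deriv.has_derivative_inverse[OF assms(2) F'], of i]
    by (simp add: partial_eqI)
qed

lemma Ck_on_cong:
  assumes "open D" "\<And>x. x \<in> D \<Longrightarrow> F x = G x" "Ck_on k D F"
  shows "Ck_on k D G"
  using assms(2,3)
proof (induction k arbitrary: F G)
  case 0
  then show ?case by (simp cong: continuous_on_cong)
next
  case (Suc k)
  have deriv: "(G has_derivative F') (at x)" if "x \<in> D" "(F has_derivative F') (at x)" for x F'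
    using has_derivative_eq_on_open[OF assms(1) that(1) Suc.prems(1) that(2)] .
  have diff: "F differentiable (at x)" if "x \<in> D" for x
    using Suc.prems(2) that by simp
  have partials: "partial i F x = partial i G x" if "x \<in> D" for i x
    using diff[OF that] deriv[OF that] unfolding differentiable_def by (metis partial_eqI)
  have "Ck_on k D (partial i G)" for i
    using Suc.IH[of "partial i F" "partial i G"] partials Suc.prems(2) by simp
  moreover have "G differentiable (at x)" if "x \<in> D" for x
    using diff[OF that] deriv[OF that] by (auto simp: differentiable_def)
  ultimately show ?case by simp
qed

lemma Ck_on_Suc_imp_Ck_on: "Ck_on (Suc k) D F \<Longrightarrow> Ck_on k D F"
proof (induction k arbitrary: F)
  case 0
  then have "F differentiable_on D"
    by (auto simp: differentiable_on_def intro: differentiable_at_withinI)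
  then show ?case by (simp add: differentiable_imp_continuous_on)
next
  case (Suc k)
  show ?case
    unfolding Ck_on.simps(2)[of k]
  proof (intro conjI allI)
    show "\<forall>x\<in>D. F differentiable (at x)"
      using Suc.prems unfolding Ck_on.simps(2)[of "Suc k"] by (rule conjunct1)
    show "Ck_on k D (partial i F)" for i
      using Suc.prems unfolding Ck_on.simps(2)[of "Suc k"] by (intro Suc.IH) blast
  qed
qed

lemma Ck_on_const: "Ck_on k D (\<lambda>x. a)"
proof (induction k arbitrary: a)
  case 0
  then show ?case by simp
next
  case (Suc k)
  have "partial i (\<lambda>x. a) = (\<lambda>x. 0)" for i :: 'a
    by (auto intro!: ext partial_eqI)
  then show ?case using Suc by simp
qed

lemma Ck_on_add:
  assumes "open D" "Ck_on k D F" "Ck_on k D G"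
  shows "Ck_on k D (\<lambda>x. F x + G x)"
  using assms(2,3)
proof (induction k arbitrary: F G)
  case 0
  then show ?case by (simp add: continuous_on_add)
next
  case (Suc k)
  have "Ck_on k D (partial i (\<lambda>x. F x + G x))" for i
    by (rule Ck_on_cong[OF assms(1) _ Suc.IH[of "partial i F" "partial i G"]])
      (use Suc.prems in \<open>auto simp: partial_add\<close>)
  then show ?case using Suc.prems by simp
qed

lemma Ck_on_mult:
  assumes "open D" "Ck_on k D F" "Ck_on k D G"
  shows "Ck_on k D (\<lambda>x. F x * G x)"
  using assms(2,3)
proof (induction k arbitrary: F G)
  case 0
  then show ?case by (simp add: continuous_on_mult)
next
  case (Suc k)
  have lower: "Ck_on k D F" "Ck_on k D G"
    using Suc.prems by (blast intro: Ck_on_Suc_imp_Ck_on)+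
  have "Ck_on k D (\<lambda>x. F x * partial i G x + partial i F x * G x)" for i
    using Suc.prems lower by (intro Ck_on_add[OF assms(1)] Suc.IH) auto
  then have "Ck_on k D (partial i (\<lambda>x. F x * G x))" for i
    by (rule Ck_on_cong[OF assms(1), rotated])
      (use Suc.prems in \<open>auto simp: partial_mult\<close>)
  then show ?case using Suc.prems by simp
qed

text \<open>The partial derivatives of \<open>1/F\<close> are products of those of \<open>F\<close> with \<open>1/F\<close> itself, which by
  induction has one degree of smoothness less than claimed; that is enough.\<close>

lemma Ck_on_inverse:
  assumes "open D" "\<And>x. x \<in> D \<Longrightarrow> F x \<noteq> 0" "Ck_on k D F"
  shows "Ck_on k D (\<lambda>x. inverse (F x))"
  using assms(3)
proof (induction k)
  case 0
  then show ?case using assms(2) by (simp add: continuous_on_inverse)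
next
  case (Suc k)
  have "Ck_on k D (\<lambda>x. inverse (F x))"
    using Suc by (blast intro: Ck_on_Suc_imp_Ck_on)
  then have "Ck_on k D (\<lambda>x. - 1 * (partial i F x * (inverse (F x) * inverse (F x))))" for i
    using Suc.prems by (intro Ck_on_mult[OF assms(1)] Ck_on_const) auto
  then have "Ck_on k D (partial i (\<lambda>x. inverse (F x)))" for i
    by (rule Ck_on_cong[OF assms(1), rotated])
      (use Suc.prems assms(2) in \<open>auto simp: partial_inverse\<close>)
  then show ?case
    using Suc.prems assms(2) by (simp add: differentiable_inverse)
qed

lemma smooth_function_const: "smooth_function A (\<lambda>p. a)"
  by (simp add: smooth_function_def Cinf_on_def Ck_on_const)

context smooth_manifold
begin

lemma open_chart_image: "c \<in> A \<Longrightarrow> open (coord c ` chart_dom c)"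
  using charts by (auto simp: is_chart_def)

lemma chart_dom_subset: "c \<in> A \<Longrightarrow> chart_dom c \<subseteq> topspace X"
  using cover by blast

lemma smooth_function_add:
  assumes "smooth_function A h" "smooth_function A k"
  shows "smooth_function A (\<lambda>p. h p + k p)"
  using assms open_chart_image
  by (auto simp: smooth_function_def Cinf_on_def intro!: Ck_on_add)

lemma smooth_function_mult:
  assumes "smooth_function A h" "smooth_function A k"
  shows "smooth_function A (\<lambda>p. h p * k p)"
  using assms open_chart_image
  by (auto simp: smooth_function_def Cinf_on_def intro!: Ck_on_mult)

lemma smooth_function_divide:
  assumes "smooth_function A h" "smooth_function A k"
    and nonzero: "\<And>p. p \<in> topspace X \<Longrightarrow> k p \<noteq> 0"
  shows "smooth_function A (\<lambda>p. h p / k p)"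
proof -
  have "k (chart_inv c x) \<noteq> 0" if "c \<in> A" "x \<in> coord c ` chart_dom c" for c x
    using nonzero chart_dom_subset[OF that(1)] inv_into_into[OF that(2)] by blast
  then have "smooth_function A (\<lambda>p. inverse (k p))"
    using assms(2)
    by (auto simp: smooth_function_def Cinf_on_def intro!: Ck_on_inverse open_chart_image)
  then show ?thesis
    using smooth_function_mult[OF assms(1)] by (simp add: divide_inverse)
qed

end


section \<open>Metric traces\<close>

lemma metric_trace_add:
  "metric_trace g (\<lambda>c p. T c p + U c p) c p = metric_trace g T c p + metric_trace g U c p"
  by (simp add: metric_trace_def algebra_simps sum.distrib)

lemma metric_trace_scaleR:
  "metric_trace g (\<lambda>c p. h p *\<^sub>R T c p) c p = h p * metric_trace g T c p"
  by (simp add: metric_trace_def sum_distrib_left mult.left_commute)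

text \<open>The contraction \<open>g\<^sup>i\<^sup>j g\<^sub>i\<^sub>j\<close> pairs equal positions of the two matrices; symmetry of \<open>g\<close> turns it
  into the trace of the matrix product \<open>g\<^sup>-\<^sup>1 g\<close>. Positivity of \<open>g\<close> is what makes the inverse a
  genuine one.\<close>

lemma (in riemannian_manifold) metric_trace_metric:
  assumes "c \<in> A" "p \<in> chart_dom c"
  shows "metric_trace g g c p = real CARD('n)"
proof -
  have "v = 0" if "g c p *v v = 0" for v
    using metric_pos[OF assms, of v] that by (cases "v = 0") auto
  then have "\<exists>B. B ** g c p = mat 1"
    by (simp add: matrix_left_invertible_ker)
  then have inv: "invertible (g c p)"
    by (metis invertible_def matrix_left_right_inverse)
  have matrix_inv_left: "matrix_inv (g c p) ** g c p = mat 1"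
    using inv someI_ex[of "\<lambda>B. g c p ** B = mat 1 \<and> B ** g c p = mat 1"]
    by (simp add: invertible_def matrix_inv_def)
  have "metric_trace g g c p = trace (matrix_inv (g c p) ** g c p)"
    using metric_sym[OF assms]
    by (simp add: metric_trace_def trace_def matrix_matrix_mult_def)
  also have "\<dots> = real CARD('n)"
    using matrix_inv_left by (simp add: trace_I)
  finally show ?thesis .
qed


section \<open>Fluid spacetimes with a Ricci soliton on the base\<close>

theorem theorem5p1:
  fixes X :: "'a topology" and A :: "('a, 'n::finite) chart set"
    and g :: "('a, 'n) tensor2" and f \<rho> :: "'a \<Rightarrow> real"
  assumes "riemannian_manifold X A g"
    and "CARD('n) \<ge> 2"
    and "static_perfect_fluid X A g f \<rho>"
    and "\<exists>l. almost_gradient_ricci_soliton A g f l"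
  shows "einstein_manifold A g"
proof -
  interpret riemannian_manifold X A g by fact
  obtain l where soliton: "almost_gradient_ricci_soliton A g f l"
    using assms(4) by blast
  define n where "n = real CARD('n)"
  have n: "n \<ge> 2" using assms(2) by (simp add: n_def)
  have fpos: "f p > 0" if "p \<in> topspace X" for p
    using assms(3) that by (simp add: static_perfect_fluid_def)
  define b where "b = (n - 2) / (2 * (n - 1))"
  have b: "b \<ge> 0" using n by (simp add: b_def)
  have denominator_pos: "1 + b * f p > 0" if "p \<in> topspace X" for p
    using fpos[OF that] b by (simp add: add_pos_nonneg)
  define \<kappa> where "\<kappa> p = - 1 * (l p + 1 / (n - 1) * (\<rho> p * f p)) / (1 + b * f p)" for p
  have smooth: "smooth_function A f" "smooth_function A \<rho>" "smooth_function A l"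
    using assms(3) soliton
    by (auto simp: static_perfect_fluid_def almost_gradient_ricci_soliton_def)
  have "smooth_function A \<kappa>"
    unfolding \<kappa>_def
    by (intro smooth_function_divide smooth_function_mult smooth_function_add
        smooth_function_const smooth)
      (use denominator_pos in fastforce)
  moreover have "ricci g c p = \<kappa> p *\<^sub>R g c p" if c: "c \<in> A" "p \<in> chart_dom c" for c p
  proof -
    let ?S = "ricci g c p" and ?H = "hessian g f c p" and ?g = "g c p"
      and ?r = "scalar_curvature g c p" and ?L = "laplacian g f c p"
    have p: "p \<in> topspace X" using c chart_dom_subset by blast
    have fluid: "f p *\<^sub>R (?S - (?r / n) *\<^sub>R ?g) = ?H - (?L / n) *\<^sub>R ?g"
      and laplace: "?L = (b * ?r + n / (n - 1) * \<rho> p) * f p"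
      using assms(3) c by (auto simp: static_perfect_fluid_def n_def b_def Let_def)
    have sol: "?H + ?S + l p *\<^sub>R ?g = 0"
      using soliton c by (simp add: almost_gradient_ricci_soliton_def)
    have "?L + ?r + l p * n
        = metric_trace g (\<lambda>c p. hessian g f c p + ricci g c p + l p *\<^sub>R g c p) c p"
      by (simp add: metric_trace_add metric_trace_scaleR metric_trace_metric[OF c]
          laplacian_def scalar_curvature_def n_def)
    also have "\<dots> = 0"
      using sol by (simp add: metric_trace_def)
    finally have L: "?L = - ?r - l p * n" by simp
    have H: "?H = - ?S - l p *\<^sub>R ?g"
      using sol by (simp add: eq_neg_iff_add_eq_0 algebra_simps)
    have "?L / n = - (?r / n) - l p"
      using L n by (simp add: field_simps)
    then have "?H - (?L / n) *\<^sub>R ?g = - (?S - (?r / n) *\<^sub>R ?g)"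
      unfolding H by (simp add: scaleR_left_diff_distrib)
    then have "(f p + 1) *\<^sub>R (?S - (?r / n) *\<^sub>R ?g) = 0"
      using fluid by (simp only: scaleR_left_distrib scaleR_one) simp
    then have S: "?S = (?r / n) *\<^sub>R ?g"
      using fpos[OF p] by simp
    have "?r * (1 + b * f p) = - n * (l p + 1 / (n - 1) * (\<rho> p * f p))"
      using L laplace by (simp add: algebra_simps)
    then have "?r / n = \<kappa> p"
      using denominator_pos[OF p] n
      by (simp add: \<kappa>_def divide_eq_eq eq_divide_eq mult.commute)
    with S show ?thesis by simp
  qed
  ultimately show ?thesis
    by (auto simp: einstein_manifold_def)
qed

end
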